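(* Suppose that $0 < \cos\theta_i \le 1$ for every $i \in \{1,\ldots,n\}$. Then the system $\dot p(t) = -\mathcal{L}^{out} p(t)$ is globally asymptotically stable to a consensus value; that is, the consensus subspace $\{p \in \mathbb{R}^{2n} : p_1 = p_2 = \cdots = p_n\}$ is globally asymptotically stable (Lyapunov stable and globally attractive), and for every initial condition $p(0) \in \mathbb{R}^{2n}$ there exists a point $p^{*} \in \mathbb{R}^2$ with $p_i(t) \to p^{*}$ as $t \to \infty$ for all $i$. Moreover, all eigenvalues of $\mathcal{L}^{out}$ have positive real parts except two zero eigenvalues.
   Context: Let $\mathcal{G}=(\mathcal{V},\mathcal{E})$ be a connected undirected graph without self-loops on $\mathcal{V}=\{1,\ldots,n\}$, with weights $a_{ij}=a_{ji}\in\{0,1\}$ ($a_{ij}=1$ iff $i$ and $j$ are neighbors, $a_{ii}=0$), and let $\mathcal{N}_i$ be the set of neighbors of $i$. Each agent $i$ has a position $p_i\in\mathbb{R}^2$ and a constant misalignment angle $\theta_i\in\mathbb{R}$. Write $p=(p_1^T,\ldots,p_n^T)^T\in\mathbb{R}^{2n}$ and $D(\theta)=\begin{bmatrix}\cos\theta & -\sin\theta\\ \sin\theta & \cos\theta\end{bmatrix}$. The consensus dynamics under misaligned orientations is $\dot p_i=-\sum_{j\in\mathcal{N}_i}a_{ij}D(\theta_i)(p_i-p_j)$, i.e. $\dot p=-\mathcal{L}^{out}p$, where $\mathcal{L}^{out}\in\mathbb{R}^{2n\times 2n}$ is the block matrix whose $(i,i)$ block is $\sum_{j\in\mathcal{N}_i}a_{ij}D(\theta_i)$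 and whose $(i,j)$ block for $j\neq i$ is $-a_{ij}D(\theta_i)$. Eigenvalues are counted with algebraic multiplicity. *)

theory Defs
  imports "HOL-Analysis.Analysis"
begin

section \<open>Communication graph\<close>

text \<open>The vertex set is the whole finite type \<open>'n\<close>; an undirected graph is given by its
  symmetric set \<open>E\<close> of adjacent ordered pairs.\<close>

definition connected_undirected_graph :: "('n::finite \<times> 'n) set \<Rightarrow> bool" where
  "connected_undirected_graph E \<longleftrightarrow> sym E \<and> irrefl E \<and> (\<forall>i j. (i, j) \<in> E\<^sup>*)"

definition neighbors :: "('n::finite \<times> 'n) set \<Rightarrow> 'n \<Rightarrow> 'n set" where
  "neighbors E i = {j. (i, j) \<in> E}"

definition weight :: "('n::finite \<times> 'n) set \<Rightarrow> 'n \<Rightarrow> 'n \<Rightarrow> real" where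
  "weight E i j = (if (i, j) \<in> E then 1 else 0)"

section \<open>Consensus dynamics under misaligned orientations\<close>

definition rot :: "real \<Rightarrow> real^2^2" where
  "rot \<theta> = vector [vector [cos \<theta>, - sin \<theta>], vector [sin \<theta>, cos \<theta>]]"

text \<open>The index type \<open>'n \<times> 2\<close> has \<open>2 * CARD('n)\<close> elements: component \<open>(i, k)\<close> of a stacked
  vector is the \<open>k\<close>-th coordinate of agent \<open>i\<close>.\<close>

definition position :: "real^('n::finite \<times> 2) \<Rightarrow> 'n \<Rightarrow> real^2" where
  "position p i = (\<chi> k. p $ (i, k))"

definition Lout_block :: "('n::finite \<times> 'n) set \<Rightarrow> ('n \<Rightarrow> real) \<Rightarrow> 'n \<Rightarrow> 'n \<Rightarrow> real^2^2" where
  "Lout_block E \<theta> i j =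
     (if i = j then (\<Sum>l\<in>neighbors E i. weight E i l *\<^sub>R rot (\<theta> i))
      else - (weight E i j *\<^sub>R rot (\<theta> i)))"

definition Lout :: "('n::finite \<times> 'n) set \<Rightarrow> ('n \<Rightarrow> real) \<Rightarrow> real^('n \<times> 2)^('n \<times> 2)" where
  "Lout E \<theta> = (\<chi> r c. Lout_block E \<theta> (fst r) (fst c) $ snd r $ snd c)"

definition consensus_subspace :: "(real^('n::finite \<times> 2)) set" where
  "consensus_subspace = {p. \<forall>i j. position p i = position p j}"

lemma position_Lout:
  "position (- (Lout E \<theta> *v p)) i =
     - (\<Sum>j\<in>neighbors E i. weight E i j *\<^sub>R (rot (\<theta> i) *v (position p i - position p j)))"
  if "irrefl E"
proof -
  define R where "R = rot (\<theta> i)"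
  have nii: "(i, i) \<notin> E"
    using that by (simp add: irrefl_def)
  have blk: "position (Lout E \<theta> *v p) i = (\<Sum>j\<in>UNIV. Lout_block E \<theta> i j *v position p j)"
    by (simp add: position_def Lout_def vec_eq_iff matrix_vector_mult_def
        UNIV_Times_UNIV[symmetric] sum.cartesian_product case_prod_unfold del: UNIV_Times_UNIV)
  have diag: "Lout_block E \<theta> i i *v position p i
      = (\<Sum>j\<in>neighbors E i. weight E i j *\<^sub>R (R *v position p i))"
    unfolding Lout_block_def R_def if_P[OF refl] scaleR_sum_left[symmetric]
    by (rule scaleR_matrix_vector_assoc[symmetric])
  have off: "(\<Sum>j\<in>UNIV - {i}. Lout_block E \<theta> i j *v position p j)
      = (\<Sum>j\<in>neighbors E i. - (weight E i j *\<^sub>R (R *v position p j)))"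
  proof (rule sum.mono_neutral_cong_right)
    show "\<forall>j\<in>UNIV - {i} - neighbors E i. Lout_block E \<theta> i j *v position p j = 0"
      by (auto simp: Lout_block_def weight_def neighbors_def)
    show "Lout_block E \<theta> i j *v position p j = - (weight E i j *\<^sub>R (R *v position p j))"
      if "j \<in> neighbors E i" for j
      using that nii by (auto simp: Lout_block_def weight_def neighbors_def R_def
          vec_eq_iff matrix_vector_mult_def sum_negf)
  qed (use nii in \<open>auto simp: neighbors_def\<close>)
  have "position (Lout E \<theta> *v p) i
      = (\<Sum>j\<in>neighbors E i. weight E i j *\<^sub>R (R *v (position p i - position p j)))"
    unfolding blk sum.remove[OF finite UNIV_I[of i]] diag off
    by (simp add: sum_negf sum_subtractf matrix_vector_mult_diff_distrib scaleR_diff_right)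
  moreover have "position (- v) i = - position v i" for v
    by (simp add: position_def vec_eq_iff)
  ultimately show ?thesis
    by (simp add: R_def)
qed

section \<open>Stability of sets for autonomous systems\<close>

definition is_solution :: "('a::real_normed_vector \<Rightarrow> 'a) \<Rightarrow> (real \<Rightarrow> 'a) \<Rightarrow> bool" where
  "is_solution f x \<longleftrightarrow> (\<forall>t\<ge>0. (x has_vector_derivative f (x t)) (at t within {0..}))"

definition lyapunov_stable_set :: "('a::real_normed_vector \<Rightarrow> 'a) \<Rightarrow> 'a set \<Rightarrow> bool" where
  "lyapunov_stable_set f S \<longleftrightarrow>
     (\<forall>\<epsilon>>0. \<exists>\<delta>>0. \<forall>x. is_solution f x \<longrightarrow> infdist (x 0) S < \<delta>
        \<longrightarrow> (\<forall>t\<ge>0. infdist (x t) S < \<epsilon>))"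

definition globally_attractive_set :: "('a::real_normed_vector \<Rightarrow> 'a) \<Rightarrow> 'a set \<Rightarrow> bool" where
  "globally_attractive_set f S \<longleftrightarrow>
     (\<forall>x. is_solution f x \<longrightarrow> ((\<lambda>t. infdist (x t) S) \<longlongrightarrow> 0) at_top)"

definition globally_asymptotically_stable_set ::
    "('a::real_normed_vector \<Rightarrow> 'a) \<Rightarrow> 'a set \<Rightarrow> bool" where
  "globally_asymptotically_stable_set f S \<longleftrightarrow>
     lyapunov_stable_set f S \<and> globally_attractive_set f S"

text \<open>Linear systems have a solution from every initial value, so quantifying over all
  solutions is never vacuous here.\<close>

lemma linear_solution_exists:
  fixes A :: "real^'m^'m"
  shows "\<exists>x. is_solution (\<lambda>v. A *v v) x \<and> x 0 = x0"
proof -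
  define P where "P k = (((*v) A) ^^ k) x0" for k
  define c where "c i k = P k $ i / fact k" for i k
  define x where "x t = (\<chi> i. \<Sum>k. c i k * t ^ k)" for t :: real
  obtain K where K: "K > 0" "\<And>v. norm (A *v v) \<le> norm v * K"
    using bounded_linear.pos_bounded[OF matrix_vector_mul_bounded_linear[of A]] by blast
  have nP: "norm (P k) \<le> K ^ k * norm x0" for k
  proof (induction k)
    case 0
    then show ?case by (simp add: P_def)
  next
    case (Suc k)
    have "norm (P (Suc k)) \<le> norm (P k) * K"
      using K(2)[of "P k"] by (simp add: P_def)
    also have "\<dots> \<le> K ^ k * norm x0 * K"
      using Suc K(1) by (intro mult_right_mono) auto
    finally show ?case by (simp add: mult_ac)
  qed
  have summ: "summable (\<lambda>k. c i k * t ^ k)" for i and t :: real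
  proof (rule summable_comparison_test')
    show "summable (\<lambda>k. norm x0 * (inverse (fact k) * (K * \<bar>t\<bar>) ^ k))"
      by (intro summable_mult summable_exp)
    show "norm (c i k * t ^ k) \<le> norm x0 * (inverse (fact k) * (K * \<bar>t\<bar>) ^ k)" if "k \<ge> 0" for k
    proof -
      have "\<bar>P k $ i\<bar> \<le> K ^ k * norm x0"
        using nP[of k] component_le_norm_cart[of "P k" i] by linarith
      then have "\<bar>P k $ i\<bar> * (\<bar>t\<bar> ^ k / fact k) \<le> (K ^ k * norm x0) * (\<bar>t\<bar> ^ k / fact k)"
        by (rule mult_right_mono) simp
      then show ?thesis
        by (simp add: c_def abs_mult power_abs power_mult_distrib field_simps)
    qed
  qed
  have diffs: "diffs (c i) k = (\<Sum>j\<in>UNIV. A $ i $ j * c j k)" for i k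
    by (simp add: diffs_def c_def P_def matrix_vector_mult_def sum_divide_distrib
        sum_distrib_left del: of_nat_Suc)
  have comp: "((\<lambda>t. x t $ i) has_real_derivative (A *v x t) $ i) (at t)" for i t
  proof -
    have "(\<Sum>k. diffs (c i) k * t ^ k) = (\<Sum>k. \<Sum>j\<in>UNIV. A $ i $ j * (c j k * t ^ k))"
      by (simp only: diffs sum_distrib_right mult.assoc)
    also have "\<dots> = (\<Sum>j\<in>UNIV. \<Sum>k. A $ i $ j * (c j k * t ^ k))"
      by (rule suminf_sum) (intro summable_mult summ)
    also have "\<dots> = (A *v x t) $ i"
      by (simp add: matrix_vector_mult_def x_def suminf_mult[OF summ])
    finally show ?thesis
      using termdiffs_strong_converges_everywhere[of "c i" t, OF summ]
      by (simp add: x_def)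
  qed
  have "(x has_vector_derivative A *v x t) (at t within {0..})" for t
    unfolding has_vector_derivative_def
  proof (subst has_derivative_componentwise_within, rule ballI)
    fix b :: "real^'m"
    assume "b \<in> Basis"
    then obtain i where "b = axis i 1"
      by (auto simp: Basis_vec_def)
    then show "((\<lambda>t. x t \<bullet> b) has_derivative (\<lambda>h. h *\<^sub>R (A *v x t) \<bullet> b)) (at t within {0..})"
      using has_derivative_at_withinI[OF comp[of i t, unfolded has_field_derivative_def]]
      by (simp add: inner_axis mult_commute_abs)
  qed
  moreover have "x 0 = x0"
    unfolding x_def powser_zero by (simp add: vec_eq_iff c_def P_def)
  ultimately show ?thesis
    by (auto simp: is_solution_def)
qed

corollary consensus_dynamics_solution_exists:
  "\<exists>p. is_solution (\<lambda>p. - (Lout E \<theta> *v p)) p \<and> p 0 = p0"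
proof -
  have "(\<lambda>v. (- Lout E \<theta>) *v v) = (\<lambda>p. - (Lout E \<theta> *v p))"
    by (simp add: fun_eq_iff vec_eq_iff matrix_vector_mult_def sum_negf)
  then show ?thesis
    using linear_solution_exists[of "- Lout E \<theta>" p0] by simp
qed

section \<open>Eigenvalues of real square matrices\<close>

definition charpoly :: "'a::comm_ring_1^'m^'m \<Rightarrow> 'a poly" where
  "charpoly A = det (mat [:0, 1:] - map_matrix (\<lambda>a. [:a:]) A)"

definition complex_eigenvalue :: "real^'m^'m \<Rightarrow> complex \<Rightarrow> bool" where
  "complex_eigenvalue A \<mu> \<longleftrightarrow>
     (\<exists>v. v \<noteq> 0 \<and> map_matrix complex_of_real A *v v = \<mu> *s v)"

definition algebraic_multiplicity :: "real^'m^'m \<Rightarrow> complex \<Rightarrow> nat" where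
  "algebraic_multiplicity A \<mu> = order \<mu> (charpoly (map_matrix complex_of_real A))"

end

theory Submission
  imports Defs
begin

text \<open>
  Blockwise, the system matrix is a product: \<open>(L\<^sup>o\<^sup>u\<^sup>t p)\<^sub>i = D(\<theta>\<^sub>i) (L p)\<^sub>i\<close>, where \<open>L\<close> is the ordinary
  graph Laplacian. The Laplacian is symmetric and positive semidefinite, with kernel the
  consensus subspace because the graph is connected, and a rotation satisfies
  \<open>D(\<theta>) z \<bullet> z = cos \<theta> \<bar>z\<bar>\<^sup>2\<close>. So if all cosines are positive, the energy falls at least as
  fast as without misalignment at the same state, up to the factor \<open>min cos \<theta>\<^sub>i\<close>. The theorem
  has three parts, which rest on this identity.

  Stability. The Dirichlet energy \<open>\<Sum>\<^sub>E \<bar>p\<^sub>i - p\<^sub>j\<bar>\<^sup>2\<close> is a Lyapunov function: along a solution its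
  derivative is \<open>-4 \<Sum> cos \<theta>\<^sub>i \<bar>(L p)\<^sub>i\<bar>\<^sup>2\<close> (\<open>energy_has_derivative\<close>), and a Poincare inequality
  bounds the energy by a multiple of \<open>\<Sum> \<bar>(L p)\<^sub>i\<bar>\<^sup>2\<close> (\<open>energy_le_laplacian\<close>). Hence the energy decays
  exponentially, and its square root is equivalent to the distance from consensus. To see that
  positions converge, and not only their differences, note that \<open>\<Sum> D(-\<theta>\<^sub>i) p\<^sub>i\<close> is conserved since
  the blocks of \<open>L p\<close> sum to zero. The matrix \<open>\<Sum> D(-\<theta>\<^sub>i)\<close> is invertible, as its quadratic form is
  \<open>(\<Sum> cos \<theta>\<^sub>i) \<bar>z\<bar>\<^sup>2\<close>; the conserved quantity therefore determines the limit point.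

  Nonzero eigenvalues. If \<open>D(\<theta>\<^sub>i) (L v)\<^sub>i = \<mu> v\<^sub>i\<close> for all \<open>i\<close>, the real inner product with \<open>(L v)\<^sub>i\<close>,
  summed over \<open>i\<close>, yields \<open>\<Sum> cos \<theta>\<^sub>i \<bar>(L v)\<^sub>i\<bar>\<^sup>2 = Re \<mu> \<cdot> (v \<bullet> L v)\<close>: the contribution of \<open>Im \<mu>\<close> vanishes
  because \<open>L\<close> is symmetric. The left side is positive, since \<open>L v = 0\<close>
  would imply \<open>\<mu> v = 0\<close>, and \<open>v \<bullet> L v\<close> is nonnegative.

  Multiplicity of zero. Let \<open>Q\<close> replace every block by the block of one fixed agent. Its columns
  lie in the kernel of \<open>A = L\<^sup>o\<^sup>u\<^sup>t\<close>, so \<open>A Q = 0\<close> and \<open>(x - A) (x - Q) = x (x - (A + Q))\<close>. Taking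
  determinants, the multiplicities of the root 0 in the characteristic polynomials of \<open>A\<close> and \<open>Q\<close>
  add up to \<open>2n\<close> plus its multiplicity for \<open>A + Q\<close>. The last is 0 since \<open>A + Q\<close> is injective, by
  the invertibility of \<open>\<Sum> D(-\<theta>\<^sub>i)\<close> again, and \<open>Q\<close> has the characteristic polynomial
  \<open>(x - 1)\<^sup>2 x\<^bsup>2n-2\<^esup>\<close>.
\<close>

section \<open>Graph Laplacian and Dirichlet energy\<close>

definition laplacian :: "('n::finite \<times> 'n) set \<Rightarrow> ('n \<Rightarrow> 'a::real_vector) \<Rightarrow> 'n \<Rightarrow> 'a" where
  "laplacian E x i = (\<Sum>j\<in>neighbors E i. x i - x j)"

text \<open>The sum runs over ordered pairs, so each undirected edge contributes twice.\<close>

definition energy :: "('n::finite \<times> 'n) set \<Rightarrow> ('n \<Rightarrow> 'a::real_inner) \<Rightarrow> real" where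
  "energy E x = (\<Sum>(i, j)\<in>E. (norm (x i - x j))\<^sup>2)"

lemma sum_edges_swap:
  assumes "sym E"
  shows "(\<Sum>(i, j)\<in>E. f i j) = (\<Sum>(i, j)\<in>E. f j i)"
  by (rule sum.reindex_bij_witness[where i = prod.swap and j = prod.swap])
    (use assms in \<open>auto dest: symD\<close>)

text \<open>Discrete Green formula, valid in any real inner product space. It is used with values in
  \<open>\<real>\<^sup>2\<close> for the dynamics and in \<open>\<complex>\<^sup>2\<close>, with its real inner product, for the spectrum.\<close>

lemma laplacian_green:
  fixes x y :: "'n::finite \<Rightarrow> 'a::real_inner"
  assumes "sym E"
  shows "2 * (\<Sum>i\<in>UNIV. laplacian E x i \<bullet> y i) = (\<Sum>(i, j)\<in>E. (x i - x j) \<bullet> (y i - y j))"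
proof -
  have E: "E = Sigma UNIV (neighbors E)"
    by (auto simp: neighbors_def)
  have "(\<Sum>i\<in>UNIV. laplacian E x i \<bullet> y i) = (\<Sum>(i, j)\<in>Sigma UNIV (neighbors E). (x i - x j) \<bullet> y i)"
    by (simp add: laplacian_def inner_sum_left sum.Sigma)
  then have 1: "(\<Sum>i\<in>UNIV. laplacian E x i \<bullet> y i) = (\<Sum>(i, j)\<in>E. (x i - x j) \<bullet> y i)"
    by (simp flip: E)
  also have "\<dots> = (\<Sum>(i, j)\<in>E. (x j - x i) \<bullet> y j)"
    by (rule sum_edges_swap[OF assms])
  finally have 2: "(\<Sum>i\<in>UNIV. laplacian E x i \<bullet> y i) = (\<Sum>(i, j)\<in>E. (x j - x i) \<bullet> y j)" .
  have "2 * (\<Sum>i\<in>UNIV. laplacian E x i \<bullet> y i)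
      = (\<Sum>(i, j)\<in>E. (x i - x j) \<bullet> y i) + (\<Sum>(i, j)\<in>E. (x j - x i) \<bullet> y j)"
    using 1 2 by simp
  also have "\<dots> = (\<Sum>(i, j)\<in>E. (x i - x j) \<bullet> (y i - y j))"
    by (simp add: sum.distrib[symmetric] case_prod_unfold algebra_simps)
  finally show ?thesis .
qed

lemma energy_eq_laplacian:
  assumes "sym E"
  shows "energy E x = 2 * (\<Sum>i\<in>UNIV. laplacian E x i \<bullet> x i)"
  unfolding laplacian_green[OF assms] energy_def by (simp add: power2_norm_eq_inner)

text \<open>Green's formula against constant functions: a constant has no differences along edges.\<close>

lemma sum_laplacian:
  fixes x :: "'n::finite \<Rightarrow> 'a::real_inner"
  assumes "sym E"
  shows "(\<Sum>i\<in>UNIV. laplacian E x i) = 0"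
proof -
  define s where "s = (\<Sum>i\<in>UNIV. laplacian E x i)"
  have "s \<bullet> s = 0"
    using laplacian_green[OF assms, of x "\<lambda>_. s"]
    by (simp add: s_def inner_sum_left)
  then show ?thesis
    by (simp add: s_def)
qed

lemma energy_nonneg: "0 \<le> energy E x"
  unfolding energy_def by (intro sum_nonneg) auto

lemma norm_diff_squared_le:
  fixes a b :: "'a::real_inner"
  shows "(norm (a - b))\<^sup>2 \<le> 2 * (norm a)\<^sup>2 + 2 * (norm b)\<^sup>2"
proof -
  have "0 \<le> (norm (a + b))\<^sup>2" by simp
  then show ?thesis
    unfolding power2_norm_eq_inner by (simp add: algebra_simps inner_commute)
qed

text \<open>A path from \<open>i\<close> to \<open>j\<close> bounds the difference of the values at its ends by the differences
  along its edges. The constant depends on the path only, not on the function.\<close>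

lemma poincare_path:
  assumes "(i, j) \<in> E\<^sup>*"
  shows "\<exists>K\<ge>0. \<forall>x :: 'n::finite \<Rightarrow> 'a::real_inner. (norm (x i - x j))\<^sup>2 \<le> K * energy E x"
  using assms
proof (induction rule: rtrancl_induct)
  case base
  then show ?case by (intro exI[of _ 0]) auto
next
  case (step j k)
  then obtain K where K: "K \<ge> 0" "\<And>x :: 'n \<Rightarrow> 'a. (norm (x i - x j))\<^sup>2 \<le> K * energy E x"
    by auto
  have "(norm (x i - x k))\<^sup>2 \<le> (2 * K + 2) * energy E x" for x :: "'n \<Rightarrow> 'a"
  proof -
    have "(norm (x k - x j))\<^sup>2 \<le> energy E x"
      unfolding energy_def
      using member_le_sum[of "(j, k)" E "\<lambda>(i, j). (norm (x i - x j))\<^sup>2"] step(2)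
      by (auto simp: norm_minus_commute)
    moreover have "(norm (x i - x k))\<^sup>2 \<le> 2 * (norm (x i - x j))\<^sup>2 + 2 * (norm (x k - x j))\<^sup>2"
      using norm_diff_squared_le[of "x i - x j" "x k - x j"] by simp
    ultimately show ?thesis
      using K(2)[of x] by (simp add: algebra_simps)
  qed
  with K(1) show ?case by (intro exI[of _ "2 * K + 2"]) auto
qed

text \<open>There are finitely many pairs of vertices, so the constants of the individual paths have a
  common bound.\<close>

lemma poincare:
  assumes "connected_undirected_graph (E :: ('n::finite \<times> 'n) set)"
  obtains K where "K > 0"
    "\<And>(x :: 'n \<Rightarrow> 'a::real_inner) i j. (norm (x i - x j))\<^sup>2 \<le> K * energy E x"
proof -
  have "\<forall>e. \<exists>K\<ge>0. \<forall>x :: 'n \<Rightarrow> 'a. (norm (x (fst e) - x (snd e)))\<^sup>2 \<le> K * energy E x"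
    using assms poincare_path unfolding connected_undirected_graph_def by blast
  then obtain K where K: "\<And>e. K e \<ge> 0"
      "\<And>e (x :: 'n \<Rightarrow> 'a). (norm (x (fst e) - x (snd e)))\<^sup>2 \<le> K e * energy E x"
    by metis
  show ?thesis
  proof
    show "0 < 1 + (\<Sum>e\<in>UNIV. K e)"
      using K(1) by (simp add: add_pos_nonneg sum_nonneg)
    fix x :: "'n \<Rightarrow> 'a" and i j
    have "K (i, j) \<le> (\<Sum>e\<in>UNIV. K e)"
      using K(1) by (intro member_le_sum) auto
    then have "K (i, j) * energy E x \<le> (1 + (\<Sum>e\<in>UNIV. K e)) * energy E x"
      by (intro mult_right_mono energy_nonneg) auto
    with K(2)[of x "(i, j)"] show "(norm (x i - x j))\<^sup>2 \<le> (1 + (\<Sum>e\<in>UNIV. K e)) * energy E x"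
      by simp
  qed
qed

lemma laplacian_zero_imp_constant:
  fixes x :: "'n::finite \<Rightarrow> 'a::real_inner"
  assumes "connected_undirected_graph E" "\<And>i. laplacian E x i = 0"
  shows "x i = x j"
proof -
  obtain K where "K > 0" "\<And>(x :: 'n \<Rightarrow> 'a) i j. (norm (x i - x j))\<^sup>2 \<le> K * energy E x"
    by (rule poincare[OF assms(1)]) blast
  moreover have "energy E x = 0"
    using assms by (simp add: energy_eq_laplacian connected_undirected_graph_def)
  ultimately have "(norm (x i - x j))\<^sup>2 \<le> 0"
    by (metis mult_zero_right)
  then show ?thesis by simp
qed

text \<open>This replaces the spectral gap of the Laplacian. The blocks of \<open>L x\<close> sum to zero, so the
  energy is \<open>2 \<Sum> (L x)\<^sub>i \<bullet> (x\<^sub>i - x\<^sub>k)\<close> for any reference vertex \<open>k\<close>. Young's inequality splits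
  the products, and by the Poincare inequality the part in \<open>x\<^sub>i - x\<^sub>k\<close> is absorbed by the left side.\<close>

lemma energy_le_laplacian:
  assumes "connected_undirected_graph (E :: ('n::finite \<times> 'n) set)"
  obtains K where "K > 0"
    "\<And>x :: 'n \<Rightarrow> 'a::real_inner. energy E x \<le> K * (\<Sum>i\<in>UNIV. (norm (laplacian E x i))\<^sup>2)"
proof -
  have sym: "sym E"
    using assms by (simp add: connected_undirected_graph_def)
  obtain K where K: "K > 0" "\<And>(x :: 'n \<Rightarrow> 'a) i j. (norm (x i - x j))\<^sup>2 \<le> K * energy E x"
    by (rule poincare[OF assms]) blast
  fix i0 :: 'n
  define N where "N = real CARD('n)"
  have "N > 0" by (simp add: N_def)
  have "energy E x \<le> (4 * N * K) * (\<Sum>i\<in>UNIV. (norm (laplacian E x i))\<^sup>2)" for x :: "'n \<Rightarrow> 'a"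
  proof -
    define y where "y i = x i - x i0" for i
    \<comment> \<open>Young's parameter, chosen such that exactly half of the energy is absorbed.\<close>
    define c where "c = 2 * N * K"
    have "c > 0" using K(1) \<open>N > 0\<close> by (simp add: c_def)
    have young: "2 * (laplacian E x i \<bullet> y i) \<le> c * (norm (laplacian E x i))\<^sup>2 + (norm (y i))\<^sup>2 / c" for i
    proof -
      have "0 \<le> (norm (c *\<^sub>R laplacian E x i - y i))\<^sup>2 / c"
        using \<open>c > 0\<close> by simp
      also have "\<dots> = c * (norm (laplacian E x i))\<^sup>2 + (norm (y i))\<^sup>2 / c - 2 * (laplacian E x i \<bullet> y i)"
        using \<open>c > 0\<close> unfolding power2_norm_eq_inner
        by (simp add: inner_diff inner_commute field_simps power2_eq_square)
      finally show ?thesis by simp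
    qed
    have "energy E x = 2 * (\<Sum>i\<in>UNIV. laplacian E x i \<bullet> x i) - 2 * ((\<Sum>i\<in>UNIV. laplacian E x i) \<bullet> x i0)"
      by (simp add: energy_eq_laplacian[OF sym] sum_laplacian[OF sym])
    also have "\<dots> = (\<Sum>i\<in>UNIV. 2 * (laplacian E x i \<bullet> y i))"
      by (simp add: y_def inner_sum_left inner_diff_right sum_subtractf sum_distrib_left right_diff_distrib)
    also have "\<dots> \<le> (\<Sum>i\<in>UNIV. c * (norm (laplacian E x i))\<^sup>2 + (norm (y i))\<^sup>2 / c)"
      by (intro sum_mono young)
    also have "\<dots> = c * (\<Sum>i\<in>UNIV. (norm (laplacian E x i))\<^sup>2) + (\<Sum>i\<in>UNIV. (norm (y i))\<^sup>2) / c"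
      by (simp add: sum.distrib sum_distrib_left sum_divide_distrib)
    also have "(\<Sum>i\<in>UNIV. (norm (y i))\<^sup>2) \<le> (\<Sum>i\<in>(UNIV :: 'n set). K * energy E x)"
      unfolding y_def by (intro sum_mono K(2))
    also have "(\<Sum>i\<in>(UNIV :: 'n set). K * energy E x) / c = energy E x / 2"
      using K(1) \<open>N > 0\<close> by (simp add: c_def N_def)
    finally have "energy E x \<le> c * (\<Sum>i\<in>UNIV. (norm (laplacian E x i))\<^sup>2) + energy E x / 2"
      using \<open>c > 0\<close> by (simp add: divide_right_mono)
    then show ?thesis by (simp add: c_def)
  qed
  moreover have "4 * N * K > 0" using K(1) \<open>N > 0\<close> by simp
  ultimately show ?thesis using that by blast
qed

section \<open>Planar rotations\<close>

text \<open>Coefficients from any real vector space are allowed, because eigenvectors have complex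
  coordinates.\<close>

definition planar_rotation :: "real \<Rightarrow> 'a::real_vector^2 \<Rightarrow> 'a^2" where
  "planar_rotation \<theta> x = vector [cos \<theta> *\<^sub>R x $ 1 - sin \<theta> *\<^sub>R x $ 2, sin \<theta> *\<^sub>R x $ 1 + cos \<theta> *\<^sub>R x $ 2]"

lemma rot_mult_eq_planar_rotation: "rot \<theta> *v x = planar_rotation \<theta> x"
  by (simp add: rot_def planar_rotation_def vec_eq_iff forall_2 matrix_vector_mult_def sum_2)

lemma linear_planar_rotation: "linear (planar_rotation \<theta>)"
  by (rule linearI) (simp_all add: planar_rotation_def vec_eq_iff forall_2 algebra_simps)

lemma bounded_linear_planar_rotation: "bounded_linear (planar_rotation \<theta> :: real^2 \<Rightarrow> real^2)"
  using linear_planar_rotation by (rule linear_conv_bounded_linear[THEN iffD1])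

text \<open>The sine terms cancel because the real inner product of the coordinates is symmetric.\<close>

lemma inner_planar_rotation:
  fixes x :: "'a::real_inner^2"
  shows "planar_rotation \<theta> x \<bullet> x = cos \<theta> * (norm x)\<^sup>2"
  unfolding power2_norm_eq_inner
  by (simp add: planar_rotation_def inner_vec_def sum_2 inner_diff inner_add inner_commute algebra_simps)

lemma planar_rotation_inverse: "planar_rotation (- \<theta>) (planar_rotation \<theta> x) = x"
proof -
  have "cos \<theta> * cos \<theta> + sin \<theta> * sin \<theta> = 1"
    using sin_cos_squared_add3[of \<theta>] by simp
  then show ?thesis
    by (simp add: planar_rotation_def vec_eq_iff forall_2 scaleR_diff_right scaleR_add_right algebra_simps)
      (simp flip: scaleR_add_left add: add.commute)
qed

definition rotation_sum :: "('n::finite \<Rightarrow> real) \<Rightarrow> 'a::real_vector^2 \<Rightarrow> 'a^2" where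
  "rotation_sum \<theta> c = (\<Sum>i\<in>UNIV. planar_rotation (- \<theta> i) c)"

lemma linear_rotation_sum: "linear (rotation_sum \<theta>)"
  unfolding rotation_sum_def by (intro linear_compose_sum ballI linear_planar_rotation)

text \<open>Cauchy-Schwarz applied to the quadratic form of the sum of rotations. If the cosines have a
  positive sum, this is a quantitative form of injectivity.\<close>

lemma norm_rotation_sum_ge:
  fixes c :: "'a::real_inner^2"
  shows "(\<Sum>i\<in>UNIV. cos (\<theta> i)) * norm c \<le> norm (rotation_sum \<theta> c)"
proof (cases "c = 0")
  case False
  have "(\<Sum>i\<in>UNIV. cos (\<theta> i)) * (norm c)\<^sup>2 = rotation_sum \<theta> c \<bullet> c"
    by (simp add: rotation_sum_def inner_sum_left inner_planar_rotation sum_distrib_right)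
  also have "\<dots> \<le> norm (rotation_sum \<theta> c) * norm c"
    by (rule norm_cauchy_schwarz)
  finally show ?thesis
    using False by (simp add: power2_eq_square mult.assoc[symmetric])
qed simp

section \<open>Block form of the misaligned Laplacian\<close>

definition agent_block :: "'a^('n::finite \<times> 2) \<Rightarrow> 'n \<Rightarrow> 'a^2" where
  "agent_block v i = (\<chi> k. v $ (i, k))"

lemma position_eq_agent_block: "position = agent_block"
  by (simp add: fun_eq_iff position_def agent_block_def)

lemma agent_block_Lout:
  assumes "irrefl E"
  shows "agent_block (Lout E \<theta> *v p) i = planar_rotation (\<theta> i) (laplacian E (agent_block p) i)"
proof -
  have "position (- (Lout E \<theta> *v p)) i = - position (Lout E \<theta> *v p) i"
    by (simp add: position_def vec_eq_iff)
  then have "position (Lout E \<theta> *v p) i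
      = (\<Sum>j\<in>neighbors E i. weight E i j *\<^sub>R (rot (\<theta> i) *v (position p i - position p j)))"
    using position_Lout[OF assms, of \<theta> p i] by simp
  also have "\<dots> = (\<Sum>j\<in>neighbors E i. planar_rotation (\<theta> i) (position p i - position p j))"
    by (rule sum.cong) (auto simp: weight_def neighbors_def rot_mult_eq_planar_rotation)
  also have "\<dots> = planar_rotation (\<theta> i) (laplacian E (position p) i)"
    by (simp add: laplacian_def linear_sum[OF linear_planar_rotation])
  finally show ?thesis
    by (simp add: position_eq_agent_block)
qed

text \<open>The matrix is real, so it acts separately on real and imaginary parts.\<close>

lemma agent_block_complex_Lout:
  assumes "irrefl E"
  shows "agent_block (map_matrix complex_of_real (Lout E \<theta>) *v v) i
    = planar_rotation (\<theta> i) (laplacian E (agent_block v) i)"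
proof -
  define re im where "re = (\<chi> r. Re (v $ r))" and "im = (\<chi> r. Im (v $ r))"
  have "Re ((map_matrix complex_of_real (Lout E \<theta>) *v v) $ r) = (Lout E \<theta> *v re) $ r"
       "Im ((map_matrix complex_of_real (Lout E \<theta>) *v v) $ r) = (Lout E \<theta> *v im) $ r" for r
    by (simp_all add: re_def im_def matrix_vector_mult_def map_matrix_def)
  moreover have "(Lout E \<theta> *v p) $ (i, k) = planar_rotation (\<theta> i) (laplacian E (agent_block p) i) $ k" for p k
    using agent_block_Lout[OF assms, of \<theta> p i] by (simp add: agent_block_def vec_eq_iff)
  ultimately show ?thesis
    by (simp add: agent_block_def[of "_ *v _"] vec_eq_iff forall_2 complex_eq_iff planar_rotation_def laplacian_def)
      (simp add: agent_block_def re_def im_def)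
qed

section \<open>Energy decay and consensus\<close>

lemma bounded_linear_position: "bounded_linear (\<lambda>p. position p i)"
  by (rule linear_conv_bounded_linear[THEN iffD1], rule linearI) (simp_all add: position_def vec_eq_iff)

lemma norm_squared_eq_sum_position:
  "(norm p)\<^sup>2 = (\<Sum>i\<in>UNIV. (norm (position p i))\<^sup>2)"
  unfolding power2_norm_eq_inner inner_vec_def position_def
  by (simp add: UNIV_Times_UNIV[symmetric] sum.cartesian_product case_prod_unfold del: UNIV_Times_UNIV)

text \<open>The nearest consensus state need not be known: the one in which every agent sits at the
  position of a fixed agent is close enough, by the Poincare inequality.\<close>

lemma infdist_consensus_le:
  assumes "connected_undirected_graph (E :: ('n::finite \<times> 'n) set)"
  obtains K where "K > 0"
    "\<And>p :: real^('n \<times> 2). infdist p consensus_subspace \<le> K * sqrt (energy E (position p))"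
proof -
  obtain K where K: "K > 0"
      "\<And>(x :: 'n \<Rightarrow> real^2) i j. (norm (x i - x j))\<^sup>2 \<le> K * energy E x"
    by (rule poincare[OF assms]) blast
  fix i0 :: 'n
  define N where "N = real CARD('n)"
  have "N > 0" by (simp add: N_def)
  have "infdist p consensus_subspace \<le> sqrt (N * K) * sqrt (energy E (position p))"
    for p :: "real^('n \<times> 2)"
  proof -
    define s :: "real^('n \<times> 2)" where "s = (\<chi> r. p $ (i0, snd r))"
    have s: "position s i = position p i0" for i
      by (simp add: s_def position_def)
    have "(norm (p - s))\<^sup>2 = (\<Sum>i\<in>UNIV. (norm (position p i - position p i0))\<^sup>2)"
      unfolding norm_squared_eq_sum_position
      by (simp add: bounded_linear.linear[OF bounded_linear_position, THEN linear_diff] s)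
    also have "\<dots> \<le> (\<Sum>i\<in>(UNIV :: 'n set). K * energy E (position p))"
      by (intro sum_mono K(2))
    finally have "norm (p - s) \<le> sqrt (N * K * energy E (position p))"
      by (intro real_le_rsqrt) (simp add: N_def mult.assoc)
    moreover have "infdist p consensus_subspace \<le> dist p s"
      by (rule infdist_le) (simp add: consensus_subspace_def s)
    ultimately show ?thesis
      by (simp add: dist_norm real_sqrt_mult)
  qed
  moreover have "sqrt (N * K) > 0"
    using K(1) \<open>N > 0\<close> by simp
  ultimately show ?thesis using that by blast
qed

text \<open>The energy depends on differences only, so it does not change if a consensus state is
  subtracted first.\<close>

lemma energy_le_infdist_consensus:
  fixes E :: "('n::finite \<times> 'n) set"
  obtains K where "K > 0"
    "\<And>p :: real^('n \<times> 2). sqrt (energy E (position p)) \<le> K * infdist p consensus_subspace"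
proof -
  \<comment> \<open>The summand 1 keeps the constant positive when there are no edges, that is, for one agent.\<close>
  define K where "K = sqrt (4 * real (card E) + 1)"
  have "K > 0" by (simp add: K_def add_nonneg_pos)
  have dist: "sqrt (energy E (position p)) \<le> K * dist p s"
    if "s \<in> consensus_subspace" for p s :: "real^('n \<times> 2)"
  proof -
    have diff: "position p i - position p j = position (p - s) i - position (p - s) j" for i j
      using that
      by (auto simp: consensus_subspace_def bounded_linear.linear[OF bounded_linear_position, THEN linear_diff])
    have block: "(norm (position (p - s) i))\<^sup>2 \<le> (dist p s)\<^sup>2" for i
      unfolding dist_norm norm_squared_eq_sum_position[of "p - s"]
      by (rule member_le_sum) auto
    have "energy E (position p) \<le> (\<Sum>(i, j)\<in>E. 4 * (dist p s)\<^sup>2)"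
      unfolding energy_def
    proof (rule sum_mono, clarify)
      fix i j
      show "(norm (position p i - position p j))\<^sup>2 \<le> 4 * (dist p s)\<^sup>2"
        using norm_diff_squared_le[of "position (p - s) i" "position (p - s) j"] block[of i] block[of j]
        unfolding diff by linarith
    qed
    also have "\<dots> \<le> (K * dist p s)\<^sup>2"
      by (simp add: K_def power_mult_distrib algebra_simps)
    finally show ?thesis
      using \<open>K > 0\<close> by (intro real_le_lsqrt) auto
  qed
  have ne: "(consensus_subspace :: (real^('n \<times> 2)) set) \<noteq> {}"
    by (auto simp: consensus_subspace_def position_def intro!: exI[of _ 0])
  have "sqrt (energy E (position p)) / K \<le> infdist p consensus_subspace" for p :: "real^('n \<times> 2)"
    unfolding infdist_notempty[OF ne]
    using dist \<open>K > 0\<close> by (intro cINF_greatest ne) (simp add: field_simps)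
  with \<open>K > 0\<close> show ?thesis
    using that[of K] by (simp add: field_simps)
qed

context
  fixes E :: "('n::finite \<times> 'n) set" and \<theta> :: "'n \<Rightarrow> real" and p :: "real \<Rightarrow> real^('n \<times> 2)"
  assumes graph: "connected_undirected_graph E"
    and sol: "is_solution (\<lambda>p. - (Lout E \<theta> *v p)) p"
begin

lemma position_has_derivative:
  assumes "t \<ge> 0"
  shows "((\<lambda>t. position (p t) i) has_vector_derivative
           - planar_rotation (\<theta> i) (laplacian E (position (p t)) i)) (at t within {0..})"
proof -
  have "irrefl E"
    using graph by (simp add: connected_undirected_graph_def)
  then have "position (- (Lout E \<theta> *v p t)) i
      = - planar_rotation (\<theta> i) (laplacian E (position (p t)) i)"
    unfolding linear_neg[OF bounded_linear.linear[OF bounded_linear_position]]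
    by (simp add: position_eq_agent_block agent_block_Lout)
  moreover have "(p has_vector_derivative - (Lout E \<theta> *v p t)) (at t within {0..})"
    using sol assms by (simp add: is_solution_def)
  ultimately show ?thesis
    using bounded_linear.has_vector_derivative[OF bounded_linear_position] by metis
qed

text \<open>By Green's formula the derivative is \<open>4 \<Sum> (L p)\<^sub>i \<bullet> p'\<^sub>i\<close> with \<open>p'\<^sub>i = - D(\<theta>\<^sub>i) (L p)\<^sub>i\<close>, and a rotation
  contributes its cosine to the quadratic form.\<close>

lemma energy_has_derivative:
  assumes "t \<ge> 0"
  shows "((\<lambda>t. energy E (position (p t))) has_real_derivative
           - 4 * (\<Sum>i\<in>UNIV. cos (\<theta> i) * (norm (laplacian E (position (p t)) i))\<^sup>2)) (at t within {0..})"
proof -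
  define x where "x = position (p t)"
  define v where "v i = - planar_rotation (\<theta> i) (laplacian E x i)" for i
  have "((\<lambda>t. (position (p t) i - position (p t) j) \<bullet> (position (p t) i - position (p t) j))
      has_vector_derivative (x i - x j) \<bullet> (v i - v j) + (v i - v j) \<bullet> (x i - x j)) (at t within {0..})" for i j
    unfolding x_def v_def
    by (intro bounded_bilinear.has_vector_derivative[OF bounded_bilinear_inner]
        has_vector_derivative_diff position_has_derivative assms)
  then have "((\<lambda>t. \<Sum>e\<in>E. (position (p t) (fst e) - position (p t) (snd e)) \<bullet> (position (p t) (fst e) - position (p t) (snd e)))
      has_vector_derivative (\<Sum>e\<in>E. 2 * ((x (fst e) - x (snd e)) \<bullet> (v (fst e) - v (snd e))))) (at t within {0..})"
    by (intro has_vector_derivative_sum) (simp add: inner_commute)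
  moreover have "(\<Sum>e\<in>E. 2 * ((x (fst e) - x (snd e)) \<bullet> (v (fst e) - v (snd e))))
      = - 4 * (\<Sum>i\<in>UNIV. cos (\<theta> i) * (norm (laplacian E x i))\<^sup>2)"
  proof -
    have "(\<Sum>i\<in>UNIV. laplacian E x i \<bullet> v i) = - (\<Sum>i\<in>UNIV. cos (\<theta> i) * (norm (laplacian E x i))\<^sup>2)"
      by (simp add: v_def inner_commute[of _ "planar_rotation _ _"] inner_planar_rotation sum_negf)
    then show ?thesis
      using laplacian_green[of E x v] graph
      by (simp add: connected_undirected_graph_def case_prod_unfold flip: sum_distrib_left)
  qed
  ultimately show ?thesis
    by (simp add: energy_def power2_norm_eq_inner case_prod_unfold x_def
        has_real_derivative_iff_has_vector_derivative)
qed

text \<open>Undoing the misalignment in the velocity of agent \<open>i\<close> leaves \<open>- (L p)\<^sub>i\<close>, and these blocks sum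
  to zero.\<close>

lemma rotated_sum_conserved:
  assumes "t \<ge> 0"
  shows "(\<Sum>i\<in>UNIV. planar_rotation (- \<theta> i) (position (p t) i))
       = (\<Sum>i\<in>UNIV. planar_rotation (- \<theta> i) (position (p 0) i))"
proof -
  have "((\<lambda>t. \<Sum>i\<in>UNIV. planar_rotation (- \<theta> i) (position (p t) i)) has_vector_derivative 0)
      (at t within {0..})" if "t \<ge> 0" for t
  proof -
    have "((\<lambda>t. \<Sum>i\<in>UNIV. planar_rotation (- \<theta> i) (position (p t) i)) has_vector_derivative
        (\<Sum>i\<in>UNIV. planar_rotation (- \<theta> i) (- planar_rotation (\<theta> i) (laplacian E (position (p t)) i))))
      (at t within {0..})"
      by (intro has_vector_derivative_sum position_has_derivative that
          bounded_linear.has_vector_derivative[OF bounded_linear_planar_rotation])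
    moreover have "sym E"
      using graph by (simp add: connected_undirected_graph_def)
    ultimately show ?thesis
      by (simp add: linear_neg[OF linear_planar_rotation] planar_rotation_inverse sum_negf sum_laplacian)
  qed
  then show ?thesis
    using assms has_derivative_zero_unique[of "{0..}"
        "\<lambda>t. \<Sum>i\<in>UNIV. planar_rotation (- \<theta> i) (position (p t) i)" t 0]
    by (simp add: has_vector_derivative_def)
qed

end

text \<open>The product \<open>exp (\<alpha> t) f t\<close> is nonincreasing.\<close>

lemma gronwall_decay:
  fixes f f' :: "real \<Rightarrow> real"
  assumes "\<And>t. t \<ge> 0 \<Longrightarrow> (f has_real_derivative f' t) (at t within {0..})"
    and "\<And>t. t \<ge> 0 \<Longrightarrow> f' t \<le> - \<alpha> * f t" and "t \<ge> 0"
  shows "f t \<le> f 0 * exp (- \<alpha> * t)"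
proof -
  have "((\<lambda>t. exp (\<alpha> * t) * f t) has_real_derivative exp (\<alpha> * s) * (f' s + \<alpha> * f s)) (at s within {0..t})"
    if "0 \<le> s" for s
    by (rule derivative_eq_intros DERIV_subset[OF assms(1)[OF that]] refl | force)+
      (simp add: algebra_simps)
  then obtain s where s: "s \<in> {0..t}"
      "exp (\<alpha> * t) * f t - f 0 = exp (\<alpha> * s) * (f' s + \<alpha> * f s) * t"
    using mvt_very_simple[OF assms(3), of "\<lambda>t. exp (\<alpha> * t) * f t" "\<lambda>s h. exp (\<alpha> * s) * (f' s + \<alpha> * f s) * h"]
    by (auto simp: has_field_derivative_def)
  have "exp (\<alpha> * s) * (f' s + \<alpha> * f s) * t \<le> 0"
    using assms(2)[of s] s(1) by (intro mult_nonpos_nonneg mult_nonneg_nonpos) auto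
  with s(2) have "exp (\<alpha> * t) * f t \<le> f 0" by simp
  then show ?thesis
    by (simp add: exp_minus field_simps)
qed

lemma energy_decay:
  fixes E :: "('n::finite \<times> 'n) set" and \<theta> :: "'n \<Rightarrow> real"
  assumes "connected_undirected_graph E" and cos_pos: "\<And>i. 0 < cos (\<theta> i)"
  obtains \<alpha> where "\<alpha> > 0"
    "\<And>p t. is_solution (\<lambda>p. - (Lout E \<theta> *v p)) p \<Longrightarrow> t \<ge> 0
       \<Longrightarrow> energy E (position (p t)) \<le> energy E (position (p 0)) * exp (- \<alpha> * t)"
proof -
  obtain K where K: "K > 0"
      "\<And>x :: 'n \<Rightarrow> real^2. energy E x \<le> K * (\<Sum>i\<in>UNIV. (norm (laplacian E x i))\<^sup>2)"
    by (rule energy_le_laplacian[OF assms(1)]) blast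
  define c where "c = Min (range (\<lambda>i. cos (\<theta> i)))"
  have c: "c > 0" "\<And>i. c \<le> cos (\<theta> i)"
    using cos_pos by (auto simp: c_def)
  show ?thesis
  proof
    show "4 * c / K > 0" using c K by simp
    fix p and t :: real
    assume sol: "is_solution (\<lambda>p. - (Lout E \<theta> *v p)) p" and "t \<ge> 0"
    show "energy E (position (p t)) \<le> energy E (position (p 0)) * exp (- (4 * c / K) * t)"
    proof (rule gronwall_decay[OF energy_has_derivative[OF assms(1) sol] _ \<open>t \<ge> 0\<close>])
      fix t :: real
      let ?l = "laplacian E (position (p t))"
      have "c / K * energy E (position (p t)) \<le> c * (\<Sum>i\<in>UNIV. (norm (?l i))\<^sup>2)"
        using mult_left_mono[OF K(2)[of "position (p t)"], of "c / K"] c(1) K(1) by simp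
      also have "\<dots> \<le> (\<Sum>i\<in>UNIV. cos (\<theta> i) * (norm (?l i))\<^sup>2)"
        unfolding sum_distrib_left by (intro sum_mono mult_right_mono c) auto
      finally show "- 4 * (\<Sum>i\<in>UNIV. cos (\<theta> i) * (norm (?l i))\<^sup>2) \<le> - (4 * c / K) * energy E (position (p t))"
        by simp
    qed
  qed
qed

lemma consensus_globally_asymptotically_stable:
  assumes "connected_undirected_graph E" and "\<And>i. 0 < cos (\<theta> i)"
  shows "globally_asymptotically_stable_set (\<lambda>p. - (Lout E \<theta> *v p)) consensus_subspace"
proof -
  obtain \<alpha> where \<alpha>: "\<alpha> > 0"
    "\<And>p t. is_solution (\<lambda>p. - (Lout E \<theta> *v p)) p \<Longrightarrow> t \<ge> 0
       \<Longrightarrow> energy E (position (p t)) \<le> energy E (position (p 0)) * exp (- \<alpha> * t)"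
    by (rule energy_decay[where \<theta> = \<theta>, OF assms]) blast
  obtain a where a: "a > 0" "\<And>p. infdist p consensus_subspace \<le> a * sqrt (energy E (position p))"
    by (rule infdist_consensus_le[OF assms(1)]) blast
  obtain b where b: "b > 0" "\<And>p. sqrt (energy E (position p)) \<le> b * infdist p consensus_subspace"
    by (rule energy_le_infdist_consensus) blast
  have root: "sqrt (exp (- \<alpha> * t)) = exp (- \<alpha> * t / 2)" for t
    by (rule real_sqrt_unique) (simp_all add: power2_eq_square flip: exp_add)
  then have root: "sqrt (exp (- (\<alpha> * t))) = exp (- (\<alpha> * t) / 2)" for t
    by simp
  have decay: "infdist (p t) consensus_subspace \<le> a * b * infdist (p 0) consensus_subspace * exp (- \<alpha> * t / 2)"
    if "is_solution (\<lambda>p. - (Lout E \<theta> *v p)) p" "t \<ge> 0" for p t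
  proof -
    have "sqrt (energy E (position (p t))) \<le> sqrt (energy E (position (p 0)) * exp (- \<alpha> * t))"
      using \<alpha>(2)[OF that] by simp
    also have "\<dots> = sqrt (energy E (position (p 0))) * exp (- \<alpha> * t / 2)"
      by (simp add: real_sqrt_mult root)
    also have "\<dots> \<le> b * infdist (p 0) consensus_subspace * exp (- \<alpha> * t / 2)"
      by (intro mult_right_mono b) auto
    finally have "a * sqrt (energy E (position (p t))) \<le> a * (b * infdist (p 0) consensus_subspace * exp (- \<alpha> * t / 2))"
      using a(1) by (intro mult_left_mono) auto
    with a(2)[of "p t"] show ?thesis by (simp add: mult.assoc)
  qed
  have "lyapunov_stable_set (\<lambda>p. - (Lout E \<theta> *v p)) consensus_subspace"
    unfolding lyapunov_stable_set_def
  proof (intro allI impI)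
    fix \<epsilon> :: real
    assume "\<epsilon> > 0"
    show "\<exists>\<delta>>0. \<forall>p. is_solution (\<lambda>p. - (Lout E \<theta> *v p)) p \<longrightarrow> infdist (p 0) consensus_subspace < \<delta>
        \<longrightarrow> (\<forall>t\<ge>0. infdist (p t) consensus_subspace < \<epsilon>)"
    proof (intro exI[of _ "\<epsilon> / (a * b)"] conjI allI impI)
      show "0 < \<epsilon> / (a * b)" using \<open>\<epsilon> > 0\<close> a(1) b(1) by simp
      fix p and t :: real
      assume sol: "is_solution (\<lambda>p. - (Lout E \<theta> *v p)) p" and "t \<ge> 0"
        and "infdist (p 0) consensus_subspace < \<epsilon> / (a * b)"
      then have small: "a * b * infdist (p 0) consensus_subspace < \<epsilon>"
        using a(1) b(1) by (simp add: field_simps)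
      have "a * b * infdist (p 0) consensus_subspace * exp (- \<alpha> * t / 2)
          \<le> a * b * infdist (p 0) consensus_subspace * 1"
        using a(1) b(1) \<alpha>(1) \<open>t \<ge> 0\<close> by (intro mult_left_mono) (auto simp: infdist_nonneg)
      with decay[OF sol \<open>t \<ge> 0\<close>] small
      show "infdist (p t) consensus_subspace < \<epsilon>" by linarith
    qed
  qed
  moreover have "globally_attractive_set (\<lambda>p. - (Lout E \<theta> *v p)) consensus_subspace"
    unfolding globally_attractive_set_def
  proof (intro allI impI)
    fix p
    assume sol: "is_solution (\<lambda>p. - (Lout E \<theta> *v p)) p"
    let ?c = "a * b * infdist (p 0) consensus_subspace"
    have "filterlim (\<lambda>t. - \<alpha> * t / 2) at_bot at_top"
      using \<alpha>(1) filterlim_tendsto_neg_mult_at_bot[OF tendsto_const, of "- \<alpha> / 2" "\<lambda>t. t" at_top]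
      by (simp add: filterlim_ident)
    then have "((\<lambda>t. ?c * exp (- \<alpha> * t / 2)) \<longlongrightarrow> ?c * 0) at_top"
      by (intro tendsto_mult_left filterlim_compose[OF exp_at_bot])
    moreover have "\<forall>\<^sub>F t in at_top. infdist (p t) consensus_subspace \<le> ?c * exp (- \<alpha> * t / 2)"
      using eventually_ge_at_top[of 0] by eventually_elim (rule decay[OF sol])
    ultimately show "((\<lambda>t. infdist (p t) consensus_subspace) \<longlongrightarrow> 0) at_top"
      using Lim_null_comparison[of "\<lambda>t. infdist (p t) consensus_subspace"
          "\<lambda>t. ?c * exp (- \<alpha> * t / 2)" at_top]
      by (simp add: infdist_nonneg)
  qed
  ultimately show ?thesis
    by (simp add: globally_asymptotically_stable_set_def)
qed

text \<open>The limit solves \<open>(\<Sum> D(-\<theta>\<^sub>i)) p\<^sup>* = \<Sum> D(-\<theta>\<^sub>i) p\<^sub>i(0)\<close>. The right side is conserved, so applying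
  \<open>\<Sum> D(-\<theta>\<^sub>j)\<close> to \<open>p\<^sub>i(t) - p\<^sup>*\<close> leaves \<open>\<Sum> D(-\<theta>\<^sub>j) (p\<^sub>i(t) - p\<^sub>j(t))\<close>, which tends to zero because the
  agents approach each other.\<close>

lemma solutions_converge_to_common_point:
  fixes E :: "('n::finite \<times> 'n) set"
  assumes "connected_undirected_graph E" and cos_pos: "\<And>i. 0 < cos (\<theta> i)"
  shows "\<exists>pstar. \<forall>p. is_solution (\<lambda>p. - (Lout E \<theta> *v p)) p \<and> p 0 = p0
    \<longrightarrow> (\<forall>i. ((\<lambda>t. position (p t) i) \<longlongrightarrow> pstar) at_top)"
proof -
  define C where "C = (\<Sum>i\<in>UNIV. cos (\<theta> i))"
  have "C > 0"
    unfolding C_def by (intro sum_pos cos_pos) auto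
  have "inj (rotation_sum \<theta> :: real^2 \<Rightarrow> real^2)"
    unfolding linear_injective_0[OF linear_rotation_sum]
  proof (intro allI impI)
    fix c :: "real^2"
    assume "rotation_sum \<theta> c = 0"
    then show "c = 0"
      using norm_rotation_sum_ge[of \<theta> c] \<open>C > 0\<close> unfolding C_def[symmetric]
      by (simp add: mult_le_0_iff)
  qed
  then have "surj (rotation_sum \<theta> :: real^2 \<Rightarrow> real^2)"
    by (rule linear_injective_imp_surjective[OF linear_rotation_sum]) (rule refl)
  then obtain pstar :: "real^2"
    where pstar: "rotation_sum \<theta> pstar = (\<Sum>i\<in>UNIV. planar_rotation (- \<theta> i) (position p0 i))"
    by (metis surjD)
  have "((\<lambda>t. position (p t) i) \<longlongrightarrow> pstar) at_top"
    if sol: "is_solution (\<lambda>p. - (Lout E \<theta> *v p)) p" and "p 0 = p0" for p i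
  proof -
    have gap: "((\<lambda>t. position (p t) i - position (p t) j) \<longlongrightarrow> 0) at_top" for j
    proof -
      obtain b where b: "b > 0" 
          "\<And>p. sqrt (energy E (position p)) \<le> b * infdist p consensus_subspace"
        by (rule energy_le_infdist_consensus) blast
      obtain K where K: "K > 0"
          "\<And>(x :: 'n \<Rightarrow> real^2) i j. (norm (x i - x j))\<^sup>2 \<le> K * energy E x"
        by (rule poincare[OF assms(1)]) blast
      have "((\<lambda>t. sqrt K * (b * infdist (p t) consensus_subspace)) \<longlongrightarrow> sqrt K * (b * 0)) at_top"
        using consensus_globally_asymptotically_stable[where \<theta> = \<theta>, OF assms] sol
        unfolding globally_asymptotically_stable_set_def globally_attractive_set_def
        by (intro tendsto_mult_left) blast
      moreover have "norm (position q i - position q j) \<le> sqrt K * (b * infdist q consensus_subspace)" for q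
      proof -
        have "norm (position q i - position q j) \<le> sqrt (K * energy E (position q))"
          by (intro real_le_rsqrt K(2))
        also have "\<dots> \<le> sqrt K * (b * infdist q consensus_subspace)"
          unfolding real_sqrt_mult using K(1) by (intro mult_left_mono b(2)) auto
        finally show ?thesis .
      qed
      ultimately show ?thesis
        using Lim_null_comparison[of "\<lambda>t. position (p t) i - position (p t) j"
            "\<lambda>t. sqrt K * (b * infdist (p t) consensus_subspace)" at_top]
        by simp
    qed
    define r where "r t = (\<Sum>j\<in>UNIV. planar_rotation (- \<theta> j) (position (p t) i - position (p t) j))" for t
    have "(r \<longlongrightarrow> (\<Sum>j\<in>UNIV. planar_rotation (- \<theta> j) 0)) at_top"
      unfolding r_def
      by (intro tendsto_sum bounded_linear.tendsto[OF bounded_linear_planar_rotation] gap)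
    then have "((\<lambda>t. norm (r t) / C) \<longlongrightarrow> 0) at_top"
      by (auto simp: linear_0[OF linear_planar_rotation] intro!: tendsto_norm_zero tendsto_divide_zero)
    moreover have "norm (position (p t) i - pstar) \<le> norm (r t) / C" if "t \<ge> 0" for t
    proof -
      have "rotation_sum \<theta> (position (p t) i - pstar) = r t"
        using rotated_sum_conserved[OF assms(1) sol that] pstar \<open>p 0 = p0\<close>
        by (simp add: linear_diff[OF linear_rotation_sum] r_def linear_diff[OF linear_planar_rotation] sum_subtractf)
          (simp add: rotation_sum_def)
      then show ?thesis
        using norm_rotation_sum_ge[of \<theta> "position (p t) i - pstar"] \<open>C > 0\<close>
        by (simp add: C_def field_simps)
    qed
    then have "\<forall>\<^sub>F t in at_top. norm (position (p t) i - pstar) \<le> norm (r t) / C"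
      by (auto simp: eventually_at_top_linorder)
    ultimately have "((\<lambda>t. position (p t) i - pstar) \<longlongrightarrow> 0) at_top"
      by (rule Lim_null_comparison[rotated])
    then show ?thesis
      by (simp add: LIM_zero_iff)
  qed
  then show ?thesis by blast
qed

section \<open>Spectrum\<close>

text \<open>Compare \<open>\<Sum> cos \<theta>\<^sub>i \<bar>(L v)\<^sub>i\<bar>\<^sup>2\<close> with \<open>Re \<mu> \<cdot> (v \<bullet> L v)\<close>: with the real inner product on \<open>\<complex>\<^sup>2\<close> they
  are equal. The first is positive, since \<open>L v = 0\<close> would make \<open>\<mu> v\<close> vanish.\<close>

lemma nonzero_eigenvalue_Re_pos:
  fixes E :: "('n::finite \<times> 'n) set"
  assumes graph: "connected_undirected_graph E" and cos_pos: "\<And>i. 0 < cos (\<theta> i)"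
    and "complex_eigenvalue (Lout E \<theta>) \<mu>" "\<mu> \<noteq> 0"
  shows "0 < Re \<mu>"
proof -
  have E: "irrefl E" "sym E"
    using graph by (auto simp: connected_undirected_graph_def)
  obtain v where v: "v \<noteq> 0" "map_matrix complex_of_real (Lout E \<theta>) *v v = \<mu> *s v"
    using assms(3) by (auto simp: complex_eigenvalue_def)
  define x where "x = agent_block v"
  have eig: "planar_rotation (\<theta> i) (laplacian E x i) = \<mu> *s x i" for i
    unfolding x_def agent_block_complex_Lout[OF E(1), symmetric] v(2)
    by (simp add: agent_block_def vec_eq_iff)
  define q where "q = (\<Sum>i\<in>UNIV. laplacian E x i \<bullet> x i)"
  have mult: "(\<mu> *s y) \<bullet> z = Re \<mu> * (y \<bullet> z) + Im \<mu> * ((\<i> *s y) \<bullet> z)" for y z :: "complex^2"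
    by (simp add: inner_vec_def sum_2 inner_complex_def algebra_simps)
  \<comment> \<open>\<open>L\<close> is symmetric and multiplication by \<open>\<i>\<close> is skew, so \<open>v \<bullet> \<i> L v = 0\<close>.\<close>
  have skew: "(\<Sum>i\<in>UNIV. laplacian E x i \<bullet> (\<i> *s x i)) = 0"
  proof -
    have "(\<Sum>(i, j)\<in>E. (x i - x j) \<bullet> (\<i> *s x i - \<i> *s x j)) = 0"
      by (intro sum.neutral) (auto simp: inner_vec_def sum_2 inner_complex_def algebra_simps)
    then show ?thesis
      using laplacian_green[OF E(2), of x "\<lambda>i. \<i> *s x i"] by simp
  qed
  have "(\<Sum>i\<in>UNIV. cos (\<theta> i) * (norm (laplacian E x i))\<^sup>2) = (\<Sum>i\<in>UNIV. (\<mu> *s x i) \<bullet> laplacian E x i)"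
    by (simp flip: eig add: inner_planar_rotation)
  also have "\<dots> = Re \<mu> * q"
    unfolding mult using skew
    by (simp add: sum.distrib q_def inner_commute flip: sum_distrib_left)
  finally have key: "(\<Sum>i\<in>UNIV. cos (\<theta> i) * (norm (laplacian E x i))\<^sup>2) = Re \<mu> * q" .
  obtain i where "laplacian E x i \<noteq> 0"
  proof (rule ccontr)
    assume "\<not> thesis"
    then have "\<mu> *s x i = 0" for i
      using that by (metis eig linear_0[OF linear_planar_rotation])
    with \<open>\<mu> \<noteq> 0\<close> have "v = 0"
      by (auto simp: x_def agent_block_def vec_eq_iff)
    with v(1) show False ..
  qed
  then have "0 < (\<Sum>i\<in>UNIV. cos (\<theta> i) * (norm (laplacian E x i))\<^sup>2)"
    using cos_pos less_imp_le[OF cos_pos] by (intro sum_pos2[of _ i]) simp_all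
  moreover have "q \<ge> 0"
    using energy_nonneg[of E x] by (simp add: energy_eq_laplacian[OF E(2)] q_def)
  ultimately show ?thesis
    unfolding key by (simp add: zero_less_mult_iff)
qed

lemma det_scalar_matrix_mult:
  "det ((mat c :: 'a::comm_ring_1^'n^'n) ** A) = c ^ CARD('n) * det A"
proof -
  have "mat c ** A = (\<chi> i. c *s A $ i)"
    by (simp add: vec_eq_iff matrix_matrix_mult_def mat_def if_distrib[of "\<lambda>x. x * _"] cong: if_cong)
  then show ?thesis
    using det_rows_mul[of "\<lambda>_. c" "\<lambda>i. A $ i"] by simp
qed

text \<open>If \<open>A Q = 0\<close>, expanding the product gives \<open>(x - A) (x - Q) = x (x - (A + Q))\<close>; take determinants.\<close>

lemma charpoly_mult_of_annihilating:
  fixes A Q :: "'a::comm_ring_1^'n^'n"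
  assumes "A ** Q = 0"
  shows "charpoly A * charpoly Q = [:0, 1:] ^ CARD('n) * charpoly (A + Q)"
proof -
  have "(\<Sum>k\<in>UNIV. A $ i $ k * Q $ k $ j) = 0" for i j
    using assms by (simp add: vec_eq_iff matrix_matrix_mult_def)
  then have null: "map_matrix (\<lambda>a. [:a:]) A ** map_matrix (\<lambda>a. [:a:]) Q = 0"
    by (simp add: vec_eq_iff matrix_matrix_mult_def sum_to_poly mult.commute)
  have split: "map_matrix (\<lambda>a. [:a:]) (A + Q) = map_matrix (\<lambda>a. [:a:]) A + map_matrix (\<lambda>a. [:a:]) Q"
    by (simp add: vec_eq_iff)
  have comm: "X ** mat c = mat c ** X" for X :: "'a poly^'n^'n" and c
    by (simp add: vec_eq_iff matrix_matrix_mult_def mat_def if_distrib[of "\<lambda>x. x * _"]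
        if_distrib[of "\<lambda>x. _ * x"] mult.commute cong: if_cong)
  have diff: "(B - C) ** D = B ** D - C ** D" "D ** (B - C) = D ** B - D ** C"
    for B C D :: "'a poly^'n^'n"
    by (simp_all add: vec_eq_iff matrix_matrix_mult_def algebra_simps sum_subtractf)
  have product: "(mat [:0, 1:] - map_matrix (\<lambda>a. [:a:]) A) ** (mat [:0, 1:] - map_matrix (\<lambda>a. [:a:]) Q)
      = mat [:0, 1:] ** (mat [:0, 1:] - map_matrix (\<lambda>a. [:a:]) (A + Q))"
    by (simp add: diff split null comm[of "map_matrix (\<lambda>a. [:a:]) A"] matrix_add_ldistrib)
  show ?thesis
    unfolding charpoly_def det_mul[symmetric] product det_scalar_matrix_mult ..
qed

lemma poly_det: "poly (det M) a = det (map_matrix (\<lambda>p. poly p a) M)"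
  by (simp add: det_def poly_sum poly_prod)

lemma poly_charpoly_0: "poly (charpoly A) 0 = det (- A)"
  unfolding charpoly_def poly_det
  by (rule arg_cong[of _ _ det]) (simp add: vec_eq_iff mat_def)

definition copy_block :: "'n::finite \<Rightarrow> 'a::comm_ring_1^('n \<times> 2)^('n \<times> 2)" where
  "copy_block i0 = (\<chi> r c. if c = (i0, snd r) then 1 else 0)"

lemma copy_block_mult: "(copy_block i0 *v v) $ r = v $ (i0, snd r)"
  by (simp add: copy_block_def matrix_vector_mult_def if_distrib[of "\<lambda>x. x * _"] cong: if_cong)

text \<open>Row \<open>(i, k)\<close> of \<open>x - copy_block i\<^sub>0\<close> vanishes outside the columns \<open>(i, k)\<close> and \<open>(i\<^sub>0, k)\<close>. A permutation that
  avoids the zeros must fix the rows of agent \<open>i\<^sub>0\<close>, hence by injectivity all others, so only the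
  diagonal contributes to the determinant.\<close>

lemma charpoly_copy_block:
  "charpoly (copy_block i0 :: 'a::comm_ring_1^('n::finite \<times> 2)^('n \<times> 2))
    = [:-1, 1:] ^ 2 * [:0, 1:] ^ (2 * CARD('n) - 2)"
proof -
  let ?M = "mat [:0, 1:] - map_matrix (\<lambda>a. [:a:]) (copy_block i0 :: 'a^('n \<times> 2)^('n \<times> 2))"
  have M: "?M $ r $ c = (if r = c then [:0, 1:] else 0) - (if c = (i0, snd r) then 1 else 0)" for r c
    by (simp add: mat_def copy_block_def one_pCons)
  have perm: "\<sigma> = id" if "\<sigma> permutes UNIV" "\<And>r. ?M $ r $ \<sigma> r \<noteq> 0" for \<sigma>
  proof -
    have step: "\<sigma> r = r \<or> \<sigma> r = (i0, snd r)" for r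
      using that(2)[of r] unfolding M by (auto split: if_splits)
    have "\<sigma> (i0, k) = (i0, k)" for k
      using step[of "(i0, k)"] by simp
    moreover have "inj \<sigma>"
      using that(1) by (rule permutes_inj)
    ultimately have "\<sigma> r = r" for r
      using step[of r] by (metis injD)
    then show ?thesis by (simp add: fun_eq_iff)
  qed
  have "charpoly (copy_block i0 :: 'a^('n \<times> 2)^('n \<times> 2))
      = (\<Sum>\<sigma>\<in>{id}. of_int (sign \<sigma>) * (\<Prod>r\<in>UNIV. ?M $ r $ \<sigma> r))"
    unfolding charpoly_def det_def
  proof (rule sum.mono_neutral_right)
    show "\<forall>\<sigma>\<in>{\<sigma>. \<sigma> permutes UNIV} - {id}. of_int (sign \<sigma>) * (\<Prod>r\<in>UNIV. ?M $ r $ \<sigma> r) = 0"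
    proof
      fix \<sigma> :: "'n \<times> 2 \<Rightarrow> 'n \<times> 2"
      assume "\<sigma> \<in> {\<sigma>. \<sigma> permutes UNIV} - {id}"
      then obtain r where "?M $ r $ \<sigma> r = 0"
        using perm[of \<sigma>] by blast
      then have "(\<Prod>r\<in>UNIV. ?M $ r $ \<sigma> r) = 0"
        by (intro prod_zero bexI[of _ r]) simp_all
      then show "of_int (sign \<sigma>) * (\<Prod>r\<in>UNIV. ?M $ r $ \<sigma> r) = 0"
        by simp
    qed
  qed (auto simp: permutes_id finite_permutations)
  also have "\<dots> = (\<Prod>r\<in>UNIV. ?M $ r $ r)"
    by (simp add: sign_id)
  also have "\<dots> = (\<Prod>r\<in>UNIV. if r \<in> {i0} \<times> (UNIV :: 2 set) then [:-1, 1:] else [:0, 1:])"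
    unfolding M by (intro prod.cong refl) (auto simp: one_pCons prod_eq_iff)
  also have "\<dots> = [:-1, 1:] ^ card ({i0} \<times> (UNIV :: 2 set)) * [:0, 1:] ^ card (- ({i0} \<times> (UNIV :: 2 set)))"
    by (subst prod.If_cases) auto
  also have "\<dots> = [:-1, 1:] ^ 2 * [:0, 1:] ^ (2 * CARD('n) - 2)"
    by (simp add: Compl_eq_Diff_UNIV card_Diff_subset card_cartesian_product card_prod mult.commute)
  finally show ?thesis .
qed

text \<open>The matrix \<open>Q\<close> serves as a complement for the kernel: \<open>A Q = 0\<close>, yet \<open>A + Q\<close> is injective. For if
  \<open>(A + Q) v = 0\<close>, then \<open>(L v)\<^sub>i = - D(-\<theta>\<^sub>i) v\<^bsub>i\<^sub>0\<^esub>\<close>; summing over \<open>i\<close> gives \<open>(\<Sum> D(-\<theta>\<^sub>i)) v\<^bsub>i\<^sub>0\<^esub> = 0\<close>, so \<open>v\<^bsub>i\<^sub>0\<^esub>\<close>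
  vanishes and then \<open>v\<close> is a consensus state with value zero. In particular no generalized
  eigenvectors lie above the kernel.\<close>

lemma multiplicity_zero_eigenvalue:
  fixes E :: "('n::finite \<times> 'n) set"
  assumes graph: "connected_undirected_graph E" and cos_pos: "\<And>i. 0 < cos (\<theta> i)"
  shows "algebraic_multiplicity (Lout E \<theta>) 0 = 2"
proof -
  have E: "irrefl E" "sym E"
    using graph by (auto simp: connected_undirected_graph_def)
  define A where "A = map_matrix complex_of_real (Lout E \<theta>)"
  have block: "agent_block (A *v v) i = planar_rotation (\<theta> i) (laplacian E (agent_block v) i)" for v i
    unfolding A_def by (rule agent_block_complex_Lout[OF E(1)])
  fix i0 :: 'n
  define Q :: "complex^('n \<times> 2)^('n \<times> 2)" where "Q = copy_block i0"
  have blockQ: "agent_block (Q *v v) i = agent_block v i0" for v i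
    by (simp add: agent_block_def Q_def copy_block_mult)
  have blocks_eqI: "v = w" if "\<And>i. agent_block v i = agent_block w i" for v w :: "complex^('n \<times> 2)"
    using that by (simp add: agent_block_def vec_eq_iff)
  have "A *v (Q *v v) = 0" for v
    by (rule blocks_eqI)
      (simp add: block blockQ laplacian_def linear_0[OF linear_planar_rotation],
        simp add: agent_block_def vec_eq_iff)
  then have "A ** Q = 0"
    unfolding matrix_eq by (simp add: matrix_vector_mul_assoc)
  have "v = 0" if "(A + Q) *v v = 0" for v
  proof -
    define x where "x = agent_block v"
    have "planar_rotation (\<theta> i) (laplacian E x i) + x i0 = 0" for i
    proof -
      have "agent_block (A *v v) i + agent_block (Q *v v) i = agent_block ((A + Q) *v v) i"
        by (simp add: agent_block_def vec_eq_iff matrix_vector_mult_add_rdistrib)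
      then show ?thesis
        unfolding block blockQ that x_def by (simp add: agent_block_def vec_eq_iff)
    qed
    then have "planar_rotation (\<theta> i) (laplacian E x i) = - x i0" for i
      by (simp add: eq_neg_iff_add_eq_0)
    then have lap: "laplacian E x i = - planar_rotation (- \<theta> i) (x i0)" for i
      using planar_rotation_inverse[of "\<theta> i" "laplacian E x i"]
      by (simp add: linear_neg[OF linear_planar_rotation])
    have "rotation_sum \<theta> (x i0) = 0"
      using sum_laplacian[OF E(2), of x] by (simp add: lap sum_negf rotation_sum_def)
    moreover have "0 < (\<Sum>i\<in>UNIV. cos (\<theta> i))"
      by (intro sum_pos cos_pos) auto
    ultimately have "x i0 = 0"
      using norm_rotation_sum_ge[of \<theta> "x i0"] by (simp add: mult_le_0_iff)
    moreover from this have "x i = x i0" for i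
      by (intro laplacian_zero_imp_constant[OF graph])
        (simp add: lap linear_0[OF linear_planar_rotation])
    ultimately have "agent_block v i = 0" for i
      by (simp add: x_def)
    then show ?thesis
      by (simp add: agent_block_def vec_eq_iff)
  qed
  then have "invertible (A + Q)"
    unfolding invertible_left_inverse matrix_left_invertible_ker by blast
  then have "det (A + Q) \<noteq> 0"
    by (simp add: invertible_det_nz)
  moreover have "mat (- 1) ** (A + Q) = - (A + Q)"
    by (simp add: vec_eq_iff matrix_matrix_mult_def mat_def if_distrib[of "\<lambda>x. x * _"] cong: if_cong)
  then have "det (- (A + Q)) = (- 1) ^ CARD('n \<times> 2) * det (A + Q)"
    using det_scalar_matrix_mult[of "- 1" "A + Q"] by simp
  ultimately have nz: "poly (charpoly (A + Q)) 0 \<noteq> 0"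
    by (simp add: poly_charpoly_0)
  have prod: "charpoly A * charpoly Q = [:- 0, 1:] ^ (2 * CARD('n)) * charpoly (A + Q)"
    using charpoly_mult_of_annihilating[OF \<open>A ** Q = 0\<close>] by (simp add: card_prod mult.commute)
  have "order 0 (charpoly Q) = 2 * CARD('n) - 2"
  proof -
    have "charpoly Q = [:-1, 1:] ^ 2 * [:- 0, 1:] ^ (2 * CARD('n) - 2)"
      by (simp add: Q_def charpoly_copy_block)
    then show ?thesis
      by (simp add: order_mult order_0I order_power_n_n[of 0, simplified])
  qed
  moreover have ne: "charpoly A * charpoly Q \<noteq> 0"
    using nz unfolding prod by auto
  moreover have "order 0 (charpoly A * charpoly Q) = 2 * CARD('n)"
    using ne unfolding prod by (simp only: order_mult order_power_n_n order_0I[OF nz] if_True add_0_right not_False_eq_True)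
  ultimately have "order 0 (charpoly A) + (2 * CARD('n) - 2) = 2 * CARD('n)"
    by (simp add: order_mult)
  moreover have "0 < CARD('n)"
    by simp
  ultimately have "order 0 (charpoly A) = 2"
    by arith
  then show ?thesis
    by (simp add: algebraic_multiplicity_def A_def)
qed

section \<open>Consensus under misaligned orientations\<close>

theorem theorem1:
  fixes E :: "('n::finite \<times> 'n) set" and \<theta> :: "'n \<Rightarrow> real"
  assumes "connected_undirected_graph E"
    and "\<And>i. 0 < cos (\<theta> i) \<and> cos (\<theta> i) \<le> 1"
  shows "globally_asymptotically_stable_set (\<lambda>p. - (Lout E \<theta> *v p)) consensus_subspace
    \<and> (\<forall>p0. \<exists>pstar. \<forall>p. is_solution (\<lambda>p. - (Lout E \<theta> *v p)) p \<and> p 0 = p0 \<longrightarrow>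
          (\<forall>i. ((\<lambda>t. position (p t) i) \<longlongrightarrow> pstar) at_top))
    \<and> (\<forall>\<mu>. complex_eigenvalue (Lout E \<theta>) \<mu> \<and> \<mu> \<noteq> 0 \<longrightarrow> 0 < Re \<mu>)
    \<and> algebraic_multiplicity (Lout E \<theta>) 0 = 2"
proof (intro conjI allI impI)
  have cos_pos: "0 < cos (\<theta> i)" for i
    using assms(2) by blast
  show "globally_asymptotically_stable_set (\<lambda>p. - (Lout E \<theta> *v p)) consensus_subspace"
    by (rule consensus_globally_asymptotically_stable[OF assms(1) cos_pos])
  show "\<exists>pstar. \<forall>p. is_solution (\<lambda>p. - (Lout E \<theta> *v p)) p \<and> p 0 = p0 \<longrightarrow>
      (\<forall>i. ((\<lambda>t. position (p t) i) \<longlongrightarrow> pstar) at_top)" for p0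
    by (rule solutions_converge_to_common_point[OF assms(1) cos_pos])
  show "0 < Re \<mu>" if "complex_eigenvalue (Lout E \<theta>) \<mu> \<and> \<mu> \<noteq> 0" for \<mu>
    using that nonzero_eigenvalue_Re_pos[where \<theta> = \<theta>, OF assms(1) cos_pos] by blast
  show "algebraic_multiplicity (Lout E \<theta>) 0 = 2"
    by (rule multiplicity_zero_eigenvalue[OF assms(1) cos_pos])
qed

end
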